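(* Let $n\geq 3$ be an integer. (1) If $n$ or $n-1$ is a prime number, then $S_n$ has self-centralizing cyclic subgroups. In particular, $\Gamma_{\mathfrak N}(S_n)$ is a disconnected graph. (2) If $n\geq 5$ and $\Gamma_{\mathfrak N}(S_n)$ is disconnected, then $n$ or $n-1$ is a prime number.
   Context: $S_n$ is the symmetric group of degree $n$. A subgroup $U$ of a group $G$ is self-centralizing if $C_G(U)=U$. For a finite group $G$, $\mathrm{nil}(G)=\{g\in G:\langle g,h\rangle \text{ is nilpotent for all } h\in G\}$. For a finite non-nilpotent group $G$, the nilpotent graph $\Gamma_{\mathfrak N}(G)$ is the simple undirected graph with vertex set $G-\mathrm{nil}(G)$ (set difference) in which two distinct vertices $g,h$ are adjacent if and only if $\langle g,h\rangle$ is nilpotent. *)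

theory Defs
  imports
    "HOL-Computational_Algebra.Primes"
    "HOL-Algebra.Sym_Groups"
    "HOL-Algebra.Elementary_Groups"
    "Graph_Theory.Digraph_Component"
begin

definition centralizer :: "('a, 'b) monoid_scheme \<Rightarrow> 'a set \<Rightarrow> 'a set"
  where "centralizer G U = {g \<in> carrier G. \<forall>u\<in>U. g \<otimes>\<^bsub>G\<^esub> u = u \<otimes>\<^bsub>G\<^esub> g}"

definition self_centralizing :: "'a set \<Rightarrow> ('a, 'b) monoid_scheme \<Rightarrow> bool"
  where "self_centralizing U G \<longleftrightarrow> subgroup U G \<and> centralizer G U = U"

definition cyclic_subgroup :: "'a set \<Rightarrow> ('a, 'b) monoid_scheme \<Rightarrow> bool"
  where "cyclic_subgroup U G \<longleftrightarrow> subgroup U G \<and> cyclic_group (G\<lparr>carrier := U\<rparr>)"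

definition commutator_subgroup :: "('a, 'b) monoid_scheme \<Rightarrow> 'a set \<Rightarrow> 'a set \<Rightarrow> 'a set"
  where "commutator_subgroup G H K =
    generate G (\<Union>h\<in>H. \<Union>k\<in>K. {h \<otimes>\<^bsub>G\<^esub> k \<otimes>\<^bsub>G\<^esub> inv\<^bsub>G\<^esub> h \<otimes>\<^bsub>G\<^esub> inv\<^bsub>G\<^esub> k})"

primrec lower_central :: "('a, 'b) monoid_scheme \<Rightarrow> nat \<Rightarrow> 'a set"
  where
    "lower_central G 0 = carrier G"
  | "lower_central G (Suc i) = commutator_subgroup G (lower_central G i) (carrier G)"

definition nilpotent_group :: "('a, 'b) monoid_scheme \<Rightarrow> bool"
  where "nilpotent_group G \<longleftrightarrow> (\<exists>c. lower_central G c = {\<one>\<^bsub>G\<^esub>})"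

definition nil :: "('a, 'b) monoid_scheme \<Rightarrow> 'a set"
  where "nil G = {g \<in> carrier G. \<forall>h\<in>carrier G. nilpotent_group (subgroup_generated G {g, h})}"

text \<open>An undirected edge is encoded, as usual in the graph library, by the two arcs joining its
  ends. The definition is total, but is meant for finite non-nilpotent groups only.\<close>

definition nilpotent_graph :: "('a, 'b) monoid_scheme \<Rightarrow> 'a pair_pre_digraph"
  where "nilpotent_graph G =
    \<lparr> pverts = carrier G - nil G,
      parcs = {(g, h). g \<in> carrier G - nil G \<and> h \<in> carrier G - nil G \<and> g \<noteq> h \<and>
                       nilpotent_group (subgroup_generated G {g, h})} \<rparr>"

lemma pair_graph_nilpotent_graph:
  assumes "finite (carrier G)"
  shows "pair_graph (nilpotent_graph G)"
proof
  have "parcs (nilpotent_graph G) \<subseteq> carrier G \<times> carrier G"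
    by (auto simp: nilpotent_graph_def)
  then show "finite (parcs (nilpotent_graph G))"
    using assms finite_subset by blast
  show "symmetric (with_proj (nilpotent_graph G))"
    by (auto simp: symmetric_def sym_def nilpotent_graph_def insert_commute)
qed (use assms in \<open>auto simp: nilpotent_graph_def\<close>)

text \<open>The library's predicate \<open>Digraph_Component.connected\<close> is false for the graph without
  vertices. That graph does not arise from non-nilpotent groups: if \<^term>\<open>nil G\<close> is all
  of a finite group, then the group is nilpotent.\<close>

definition disconnected :: "'a pair_pre_digraph \<Rightarrow> bool"
  where "disconnected \<Gamma> \<longleftrightarrow> \<not> Digraph_Component.connected (with_proj \<Gamma>)"

end

theory Submission
  imports Defs "HOL-Algebra.Multiplicative_Group"
begin

text \<open>
  Two observations govern the nilpotent graph. Commuting elements generate an abelian group, so they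
  are equal or adjacent as soon as they are vertices. And a nontrivial nilpotent group has a
  nontrivial centre, so adjacent elements have a common centralizing element other than the identity.

  Suppose that \<open>n\<close> or \<open>n - 1\<close> is a prime number \<open>p\<close>. A \<open>p\<close>-cycle \<open>c\<close> moves all points except at
  most one, so a permutation commuting with \<open>c\<close> is a power of \<open>c\<close>
  (\<open>commutes_with_cycle_imp_power\<close>), and the subgroup \<open>U\<close> generated by \<open>c\<close> is self-centralizing. If
  \<open>u\<close> is a nontrivial element of \<open>U\<close> and generates a nilpotent group together with \<open>h\<close>, then a
  nontrivial central element of that group lies in \<open>U\<close>, generates \<open>U\<close> because \<open>p\<close> is prime, and
  forces \<open>h\<close> into \<open>U\<close> (\<open>nilpotent_neighbours_self_centralizing\<close>). So the nontrivial elements of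
  \<open>U\<close> are cut off from the elements outside \<open>U\<close>.

  Suppose that \<open>n \<ge> 5\<close> and that neither \<open>n\<close> nor \<open>n - 1\<close> is prime. The vertices are all elements
  other than the identity (\<open>nil_sym_group\<close>). Let \<open>x\<close> be one of them, \<open>y\<close> a power of \<open>x\<close> of prime
  order \<open>p\<close>, and \<open>c\<close> one of the \<open>p\<close>-cycles of \<open>y\<close>. Then \<open>p \<le> n - 2\<close>, so \<open>c\<close> fixes two points and
  commutes with the transposition of them; each of \<open>x\<close>, \<open>y\<close>, \<open>c\<close> and this transposition commutes with
  the next one (\<open>transposition_reachable\<close>). Any two transpositions are disjoint or disjoint from a
  common third one (\<open>transpositions_reachable\<close>), and the graph is connected.
\<close>

section \<open>Nilpotency criteria\<close>

lemma (in group) subgroup_centralizer: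
  assumes "A \<subseteq> carrier G"
  shows "subgroup (centralizer G A) G"
proof
  show "centralizer G A \<subseteq> carrier G" "\<one> \<in> centralizer G A"
    using assms by (auto simp: centralizer_def)
next
  fix x y assume x: "x \<in> centralizer G A" and y: "y \<in> centralizer G A"
  have "x \<otimes> y \<otimes> a = a \<otimes> (x \<otimes> y)" if "a \<in> A" for a
  proof -
    have in_G: "x \<in> carrier G" "y \<in> carrier G" "a \<in> carrier G"
      and comm: "x \<otimes> a = a \<otimes> x" "y \<otimes> a = a \<otimes> y"
      using x y that assms by (auto simp: centralizer_def)
    have "x \<otimes> y \<otimes> a = x \<otimes> a \<otimes> y"
      using in_G comm(2) by (simp add: m_assoc)
    also have "\<dots> = a \<otimes> (x \<otimes> y)"
      using in_G comm(1) by (simp add: m_assoc)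
    finally show ?thesis .
  qed
  with x y show "x \<otimes> y \<in> centralizer G A"
    by (simp add: centralizer_def)
next
  fix x assume x: "x \<in> centralizer G A"
  have "inv x \<otimes> a = a \<otimes> inv x" if "a \<in> A" for a
  proof -
    have xa: "x \<in> carrier G" "a \<in> carrier G" "x \<otimes> a = a \<otimes> x"
      using x that assms by (auto simp: centralizer_def)
    then have "inv x \<otimes> a \<otimes> x = a"
      by (metis m_assoc inv_closed l_inv l_one)
    with xa show ?thesis
      by (metis inv_closed inv_solve_right m_closed)
  qed
  with x show "inv x \<in> centralizer G A"
    by (simp add: centralizer_def)
qed

lemma (in group) generate_in_centralizer:
  assumes "A \<subseteq> carrier G" "B \<subseteq> carrier G" "\<And>a b. a \<in> A \<Longrightarrow> b \<in> B \<Longrightarrow> a \<otimes> b = b \<otimes> a"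
  shows "generate G A \<subseteq> centralizer G B"
  using assms by (intro generate_subgroup_incl subgroup_centralizer) (auto simp: centralizer_def)

lemma (in group) nilpotent_if_commute:
  assumes "g \<in> carrier G" "h \<in> carrier G" "g \<otimes> h = h \<otimes> g"
  shows "nilpotent_group (subgroup_generated G {g, h})" (is "nilpotent_group ?H")
proof -
  let ?K = "generate G {g, h}"
  interpret H: group ?H by simp
  have K: "carrier ?H = ?K" "?K \<subseteq> carrier G"
    using assms by (auto simp: carrier_subgroup_generated generate_incl)
  have "?K \<subseteq> centralizer G {g, h}"
    using assms by (intro generate_in_centralizer) auto
  then have "?K \<subseteq> centralizer G ?K"
    using assms K by (intro generate_in_centralizer) (fastforce simp: centralizer_def)+
  then have comm: "x \<otimes> y = y \<otimes> x" if "x \<in> ?K" "y \<in> ?K" for x y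
    using that by (auto simp: centralizer_def)
  have "x \<otimes> y \<otimes> inv\<^bsub>?H\<^esub> x \<otimes> inv\<^bsub>?H\<^esub> y = \<one>" if "x \<in> carrier ?H" "y \<in> carrier ?H" for x y
  proof -
    have "x \<in> carrier G" "y \<in> carrier G" "x \<otimes> y = y \<otimes> x"
      using that K comm by auto
    then have "x \<otimes> y \<otimes> inv x \<otimes> inv y = \<one>"
      by (metis inv_closed m_assoc r_inv r_one)
    then show ?thesis
      using that by simp
  qed
  then have "lower_central ?H 1 \<subseteq> generate ?H {\<one>\<^bsub>?H\<^esub>}"
    unfolding lower_central.simps commutator_subgroup_def One_nat_def
    by (intro H.mono_generate) auto
  then have "lower_central ?H 1 \<subseteq> {\<one>\<^bsub>?H\<^esub>}"
    unfolding H.generate_one .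
  moreover have "\<one>\<^bsub>?H\<^esub> \<in> lower_central ?H 1"
    using generate.one[of ?H] by (simp add: commutator_subgroup_def)
  ultimately have "lower_central ?H 1 = {\<one>\<^bsub>?H\<^esub>}"
    by blast
  then show ?thesis
    unfolding nilpotent_group_def by blast
qed

text \<open>The last nontrivial term of the lower central series is central, because all commutators of its
  elements with the group lie in the next term.\<close>

lemma (in group) nilpotent_nontrivial_center:
  assumes "nilpotent_group G" "carrier G \<noteq> {\<one>}"
  obtains z where "z \<in> carrier G" "z \<noteq> \<one>" "\<And>x. x \<in> carrier G \<Longrightarrow> z \<otimes> x = x \<otimes> z"
proof -
  have in_carrier: "lower_central G i \<subseteq> carrier G" for i
    by (induction i) (auto simp: commutator_subgroup_def intro!: generate_incl)
  define c where "c = (LEAST c. lower_central G c = {\<one>})"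
  have c: "lower_central G c = {\<one>}" and min: "\<And>d. d < c \<Longrightarrow> lower_central G d \<noteq> {\<one>}"
    unfolding c_def using assms(1) LeastI_ex[of "\<lambda>c. lower_central G c = {\<one>}"] not_less_Least
    by (auto simp: nilpotent_group_def)
  obtain d where d: "c = Suc d"
    using assms(2) c by (cases c) auto
  have "\<one> \<in> lower_central G d"
    by (cases d) (auto simp: commutator_subgroup_def generate.one)
  with min[of d] d obtain z where z: "z \<in> lower_central G d" "z \<noteq> \<one>"
    by auto
  have zG: "z \<in> carrier G"
    using z in_carrier by auto
  have "z \<otimes> x = x \<otimes> z" if x: "x \<in> carrier G" for x
  proof -
    have "z \<otimes> x \<otimes> inv z \<otimes> inv x \<in> lower_central G c"
      unfolding d lower_central.simps commutator_subgroup_def using z x by (intro generate.incl) auto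
    then have "z \<otimes> x \<otimes> inv z \<otimes> inv x = \<one>"
      using c by simp
    then show ?thesis
      using zG x by (simp add: inv_solve_right')
  qed
  with that zG z show thesis by blast
qed

text \<open>The hypotheses say that \<open>t\<close> conjugates \<open>s\<close>, of order three, to its inverse, as in the
  symmetric group of degree three. The commutator of \<open>s\<close> and \<open>t\<close> is then \<open>s\<close> squared, which
  generates the same subgroup as \<open>s\<close>, so \<open>s\<close> survives in every term of the lower central series.\<close>

lemma (in group) not_nilpotent_if_inverts:
  assumes "s \<in> carrier G" "t \<in> carrier G" "s \<noteq> \<one>" "s \<otimes> s \<otimes> s = \<one>" "t \<otimes> s = s \<otimes> s \<otimes> t"
  shows "\<not> nilpotent_group G"
proof -
  have inv_s: "inv s = s \<otimes> s"
    using assms(1,4) by (simp add: inv_equality)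
  \<comment> \<open>The commutator of \<open>s\<close> and \<open>t\<close> is the inverse of \<open>s\<close>.\<close>
  have "inv s \<otimes> t \<otimes> s = inv s \<otimes> (s \<otimes> (s \<otimes> t))"
    using assms(1,2,5) by (simp add: m_assoc)
  also have "\<dots> = s \<otimes> t"
    using assms(1,2) by (simp flip: m_assoc)
  finally have "s \<otimes> t \<otimes> inv s = inv s \<otimes> t"
    using assms(1,2) inv_solve_right'[of "inv s \<otimes> t" "s \<otimes> t" s] by simp
  then have comm: "s \<otimes> t \<otimes> inv s \<otimes> inv t = inv s"
    using assms(1,2) m_assoc[of "inv s" t "inv t"] by simp
  have "s \<in> lower_central G i" for i
  proof (induction i)
    case (Suc i)
    let ?C = "\<Union>h\<in>lower_central G i. \<Union>k\<in>carrier G. {h \<otimes> k \<otimes> inv h \<otimes> inv k}"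
    have "s \<otimes> t \<otimes> inv s \<otimes> inv t \<in> ?C"
      using Suc assms(2) by blast
    then have "inv s \<in> generate G ?C"
      unfolding comm by (rule generate.incl)
    then have "inv s \<otimes> inv s \<in> generate G ?C"
      by (intro generate.eng)
    moreover have "inv s \<otimes> inv s = inv (s \<otimes> s)"
      using assms(1) by (simp add: inv_mult_group)
    then have "inv s \<otimes> inv s = s"
      unfolding inv_s[symmetric] using assms(1) by simp
    ultimately show ?case
      by (simp add: commutator_subgroup_def)
  qed (use assms in simp)
  then show ?thesis
    using assms(3) unfolding nilpotent_group_def by blast
qed

section \<open>Self-centralizing subgroups of prime order\<close>

lemma disconnected_if_closed:
  assumes "g \<in> pverts \<Gamma>" "h \<in> pverts \<Gamma>" "g \<in> C" "h \<notin> C"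
    and "\<And>x y. (x, y) \<in> parcs \<Gamma> \<Longrightarrow> x \<in> C \<longleftrightarrow> y \<in> C"
  shows "disconnected \<Gamma>"
proof -
  have "y \<in> C" if "(x, y) \<in> rtrancl_on A (parcs (mk_symmetric (with_proj \<Gamma>)))" "x \<in> C" for x y A
    using that by (induction rule: rtrancl_on_induct) (use assms(5) in \<open>auto simp: parcs_mk_symmetric\<close>)
  then show ?thesis
    using assms(1-4) unfolding disconnected_def connected_def strongly_connected_def reachable_def
    by (metis pverts_mk_symmetric with_proj_simps(1,3))
qed

lemma (in group) prime_order_generator:
  assumes "subgroup U G" "prime (card U)" "u \<in> U" "u \<noteq> \<one>"
  shows "generate G {u} = U"
proof -
  interpret U: group "G\<lparr>carrier := U\<rparr>"
    using assms(1) by (rule subgroup_imp_group)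
  have fin: "finite U"
    using assms(2) by (metis card.infinite not_prime_0)
  have uG: "u \<in> carrier G"
    using assms(1,3) subgroup.subset by blast
  have sub: "generate G {u} \<subseteq> U"
    using assms by (simp add: generate_subgroup_incl)
  then have "subgroup (generate G {u}) (G\<lparr>carrier := U\<rparr>)"
    using assms(1) uG by (simp add: generate_is_subgroup subgroup_incl)
  then have "card (rcosets\<^bsub>G\<lparr>carrier := U\<rparr>\<^esub> generate G {u}) * card (generate G {u}) = card U"
    using U.lagrange by (simp add: order_def)
  then have "card (generate G {u}) dvd card U"
    by (metis dvd_triv_right)
  moreover have "card (generate G {u}) \<noteq> 1"
    using generate.one[of G "{u}"] generate.incl[of u "{u}" G] assms(4) by (auto simp: card_1_singleton_iff)
  ultimately have "card (generate G {u}) = card U"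
    using assms(2) by (auto simp: prime_nat_iff)
  with fin sub show ?thesis
    by (rule card_subset_eq)
qed

text \<open>The nilpotent group generated by \<open>u\<close> and \<open>h\<close> has a nontrivial central element \<open>z\<close>. It commutes
  with the generator \<open>u\<close> of \<open>U\<close>, so it lies in \<open>U\<close> and is itself a generator of \<open>U\<close>; and \<open>h\<close>
  commutes with \<open>z\<close>, hence centralizes \<open>U\<close>. Thus the neighbours of \<open>u\<close> in the nilpotent
  graph lie in \<open>U\<close>.\<close>

lemma (in group) nilpotent_neighbours_self_centralizing:
  assumes U: "self_centralizing U G" "prime (card U)"
    and u: "u \<in> U" "u \<noteq> \<one>"
    and h: "h \<in> carrier G" "nilpotent_group (subgroup_generated G {u, h})"
  shows "h \<in> U"
proof -
  let ?N = "subgroup_generated G {u, h}"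
  interpret N: group ?N by simp
  have sub: "subgroup U G" and C: "centralizer G U = U"
    using U by (auto simp: self_centralizing_def)
  have uG: "u \<in> carrier G"
    using u sub subgroup.subset by blast
  have uh: "u \<in> carrier ?N" "h \<in> carrier ?N"
    using uG h subgroup_generated_subset_carrier_subset[of "{u, h}"] by auto
  then have "carrier ?N \<noteq> {\<one>\<^bsub>?N\<^esub>}"
    using u by auto
  then obtain z where z: "z \<in> carrier ?N" "z \<noteq> \<one>" "\<And>x. x \<in> carrier ?N \<Longrightarrow> z \<otimes> x = x \<otimes> z"
    using N.nilpotent_nontrivial_center[OF h(2)] by auto
  have zG: "z \<in> carrier G"
    using z carrier_subgroup_generated_subset by auto
  have "generate G {u} \<subseteq> centralizer G {z}"
    using z(3) uG zG uh by (intro generate_in_centralizer) auto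
  then have "z \<in> centralizer G U"
    using prime_order_generator[OF sub U(2) u] zG by (auto simp: centralizer_def)
  then have "z \<in> U"
    using C by simp
  have "generate G {z} \<subseteq> centralizer G {h}"
    using z(3) h zG uh by (intro generate_in_centralizer) auto
  then have "h \<in> centralizer G U"
    using prime_order_generator[OF sub U(2) \<open>z \<in> U\<close> z(2)] h by (auto simp: centralizer_def)
  then show ?thesis
    using C by simp
qed

lemma (in group) disconnected_if_self_centralizing_prime:
  assumes U: "self_centralizing U G" "prime (card U)" and "U \<noteq> carrier G"
  shows "disconnected (nilpotent_graph G)"
proof -
  have sub: "U \<subseteq> carrier G" "\<one> \<in> U"
    using U by (auto simp: self_centralizing_def subgroup.subset subgroup.one_closed)
  obtain g where g: "g \<in> U" "g \<noteq> \<one>"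
  proof -
    have "U \<noteq> {\<one>}"
      using U(2) by auto
    then show thesis
      using that sub by blast
  qed
  obtain h where h: "h \<in> carrier G" "h \<notin> U"
    using assms(3) sub by blast
  have not_nilpotent: "\<not> nilpotent_group (subgroup_generated G {g, h})"
    using nilpotent_neighbours_self_centralizing[OF U g] h by blast
  then have verts: "g \<notin> nil G" "h \<notin> nil G"
    using g h sub by (auto simp: nil_def insert_commute)
  have one: "\<one> \<in> nil G"
    by (auto simp: nil_def intro: nilpotent_if_commute)
  show ?thesis
  proof (rule disconnected_if_closed[of g _ h "U - {\<one>}"])
    fix x y assume "(x, y) \<in> parcs (nilpotent_graph G)"
    then show "x \<in> U - {\<one>} \<longleftrightarrow> y \<in> U - {\<one>}"
      using nilpotent_neighbours_self_centralizing[OF U] one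
      by (auto simp: nilpotent_graph_def insert_commute)
  qed (use g h sub verts in \<open>auto simp: nilpotent_graph_def\<close>)
qed

section \<open>The set nil of the symmetric group\<close>

lemma finite_sym_group: "finite (carrier (sym_group n))"
  unfolding sym_group_def by (simp add: finite_permutations)

lemma pow_sym_group: "x [^]\<^bsub>sym_group n\<^esub> (k::nat) = x ^^ k"
  by (induction k) (simp_all add: nat_pow_def sym_group_def funpow_Suc_right del: funpow.simps(2))

lemma not_in_nil_sym_group:
  assumes "y permutes {1..n}" "h permutes {1..n}"
    and "s \<in> generate (sym_group n) {y, h}" "t \<in> generate (sym_group n) {y, h}"
    and "s \<noteq> id" "s \<circ> s \<circ> s = id" "t \<circ> s = s \<circ> s \<circ> t"
  shows "y \<notin> nil (sym_group n)"
proof -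
  let ?H = "subgroup_generated (sym_group n) {y, h}"
  interpret group "sym_group n" by (rule sym_group_is_group)
  interpret H: group ?H by simp
  have "carrier ?H = generate (sym_group n) {y, h}"
    using assms(1,2) by (simp add: carrier_subgroup_generated sym_group_carrier)
  then have "\<not> nilpotent_group ?H"
    using assms by (intro H.not_nilpotent_if_inverts[of s t]) (auto simp: sym_group_mult sym_group_one)
  then show ?thesis
    using assms(2) by (auto simp: nil_def sym_group_carrier)
qed

lemma conjugate_in_generate:
  assumes "y permutes {1..n}" "h permutes {1..n}"
  shows "y \<circ> h \<circ> inv' y \<in> generate (sym_group n) {y, h}"
proof -
  have "inv' y \<in> generate (sym_group n) {y, h}"
    using assms(1) generate.inv[of y "{y, h}" "sym_group n"] by (simp add: sym_group_carrier)
  then show ?thesis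
    by (metis generate.eng generate.incl insertI1 insertI2 sym_group_mult)
qed

lemma comp_transpose:
  assumes "inj f"
  shows "f \<circ> transpose u v = transpose (f u) (f v) \<circ> f"
  using assms by (auto simp: fun_eq_iff transpose_def inj_eq)

text \<open>The transposition \<open>(p q)\<close> and its conjugate \<open>(q r)\<close> under \<open>y\<close> generate the symmetric group on
  \<open>{p, q, r}\<close>. Their product is a 3-cycle, inverted by \<open>(p q)\<close>.\<close>

lemma not_in_nil_if_overlapping_transpositions:
  assumes y: "y permutes {1..n}" and pqr: "distinct [p, q, r]" "{p, q} \<subseteq> {1..n}"
    and conj: "y \<circ> transpose p q = transpose q r \<circ> y"
  shows "y \<notin> nil (sym_group n)"
proof -
  let ?t = "transpose p q" and ?t' = "transpose q r"
  have t: "?t permutes {1..n}"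
    using pqr by (intro permutes_swap_id) auto
  have tG: "?t \<in> generate (sym_group n) {y, ?t}"
    by (simp add: generate.incl)
  have "y \<circ> ?t \<circ> inv' y = ?t'"
    unfolding conj using permutes_inv_o(1)[OF y] by (simp add: comp_assoc)
  then have "?t' \<in> generate (sym_group n) {y, ?t}"
    using conjugate_in_generate[OF y t] by simp
  with tG have sG: "?t \<circ> ?t' \<in> generate (sym_group n) {y, ?t}"
    by (metis generate.eng sym_group_mult)
  have "(?t \<circ> ?t') r \<noteq> id r"
    using pqr by simp
  then have "?t \<circ> ?t' \<noteq> id"
    by metis
  \<comment> \<open>The braid relation, together with \<open>?t\<close> and \<open>?t'\<close> being involutions, gives the rest.\<close>
  have "?t' \<circ> ?t \<circ> ?t' = ?t \<circ> ?t' \<circ> ?t"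
    using pqr by (auto simp: fun_eq_iff transpose_def)
  then have braid: "?t' (?t (?t' x)) = ?t (?t' (?t x))" for x
    by (simp add: fun_eq_iff)
  have "?t \<circ> ?t' \<circ> (?t \<circ> ?t') \<circ> (?t \<circ> ?t') = id"
       "?t \<circ> (?t \<circ> ?t') = ?t \<circ> ?t' \<circ> (?t \<circ> ?t') \<circ> ?t"
    by (simp_all add: fun_eq_iff braid)
  then show ?thesis
    using not_in_nil_sym_group[OF y t sG tG] \<open>?t \<circ> ?t' \<noteq> id\<close> by blast
qed

text \<open>Conjugation by a fixed-point-free involution \<open>y\<close> takes every transposition to itself or to a
  disjoint one, so that the preceding lemma does not apply to it. Instead, the 3-cycle
  \<open>h = (a c e)\<close> has a disjoint conjugate \<open>h'\<close> under \<open>y\<close>. Conjugation by \<open>y\<close> exchanges the commuting elements \<open>h\<close> and \<open>h'\<close>, so it inverts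
  the quotient of \<open>h\<close> by \<open>h'\<close>, which has order three.\<close>

lemma not_in_nil_if_involution_exchanges_three_pairs:
  assumes y: "y permutes {1..n}" "y \<circ> y = id"
    and ace: "distinct [a, c, e, y a, y c, y e]" "{a, c, e} \<subseteq> {1..n}"
  shows "y \<notin> nil (sym_group n)"
proof -
  define h where "h = cycle_of_list [a, c, e]"
  define h' where "h' = cycle_of_list [y a, y c, y e]"
  have h: "h permutes {1..n}"
    unfolding h_def using ace(2) by (intro permutes_subset[OF cycle_permutes]) auto
  have inv_y: "inv' y = y"
    using y(2) by (simp add: inv_unique_comp)
  have conj: "y \<circ> h \<circ> y = h'"
    using conjugation_of_cycle[of "[a, c, e]" y] ace permutes_bij[OF y(1)] inv_y
    by (simp add: h_def h'_def)
  have yG: "y \<in> generate (sym_group n) {y, h}"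
    by (simp add: generate.incl)
  have "h \<in> generate (sym_group n) {y, h}" "h' \<in> generate (sym_group n) {y, h}"
    using conjugate_in_generate[OF y(1) h] conj inv_y by (simp_all add: generate.incl)
  \<comment> \<open>The square of \<open>h'\<close> is its inverse.\<close>
  then have sG: "h \<circ> h' \<circ> h' \<in> generate (sym_group n) {y, h}"
    by (metis generate.eng sym_group_mult)
  have yy: "y (y x) = x" for x
    using y(2) by (metis comp_apply id_apply)
  have hhh: "h (h (h x)) = x" "h' (h' (h' x)) = x" for x
    using cycle_is_id_root[of "[a, c, e]"] cycle_is_id_root[of "[y a, y c, y e]"] ace(1)
    unfolding h_def[symmetric] h'_def[symmetric] by (simp_all add: numeral_3_eq_3 fun_eq_iff)
  have hh': "h' (h x) = h (h' x)" for x
    using cycles_commute[of "[a, c, e]" "[y a, y c, y e]"] ace(1)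
    unfolding h_def[symmetric] h'_def[symmetric] by (auto simp: fun_eq_iff)
  have yh: "y (h x) = h' (y x)" "y (h' x) = h (y x)" for x
    unfolding conj[symmetric] by (simp_all add: yy)
  have "h \<circ> h' \<circ> h' \<circ> (h \<circ> h' \<circ> h') \<circ> (h \<circ> h' \<circ> h') = id"
       "y \<circ> (h \<circ> h' \<circ> h') = h \<circ> h' \<circ> h' \<circ> (h \<circ> h' \<circ> h') \<circ> y"
    by (simp_all add: fun_eq_iff hh' hhh yh)
  moreover have "(h \<circ> h' \<circ> h') a \<noteq> id a"
    using ace(1) by (auto simp: h_def h'_def)
  then have "h \<circ> h' \<circ> h' \<noteq> id"
    by metis
  ultimately show ?thesis
    using not_in_nil_sym_group[OF y(1) h sG yG] by blast
qed

text \<open>An element \<open>y\<close> other than the identity has a point \<open>x\<close> for which \<open>x\<close>, \<open>y x\<close>, \<open>y (y x)\<close> are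
  distinct, or is an involution with a fixed point, or is a fixed-point-free involution. In the first
  two cases some transposition overlaps its conjugate in exactly one point. In the last case the
  degree is even, so it is at least six, and there are three disjoint pairs exchanged by \<open>y\<close>.\<close>

lemma nil_sym_group:
  assumes "n \<ge> 5"
  shows "nil (sym_group n) = {id}"
proof -
  interpret group "sym_group n" by (rule sym_group_is_group)
  have "y \<notin> nil (sym_group n)" if y: "y permutes {1..n}" "y \<noteq> id" for y
  proof -
    have inj: "inj y"
      using y permutes_inj by blast
    have in_range: "x \<in> {1..n}" "y x \<in> {1..n}" if "y x \<noteq> x" for x
      using that y permutes_not_in permutes_in_image by metis+
    consider x where "y (y x) \<noteq> x" | a c where "y a \<noteq> a" "y c = c" "c \<in> {1..n}"
      | "\<And>x. y (y x) = x" "\<And>x. x \<in> {1..n} \<Longrightarrow> y x \<noteq> x"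
      using y(2) by (auto simp: fun_eq_iff)
    then show ?thesis
    proof cases
      case 1
      then have "y x \<noteq> x" "y (y x) \<noteq> y x"
        using inj_eq[OF inj] by auto
      then show ?thesis
        using 1 in_range[of x] comp_transpose[OF inj, of x "y x"]
        by (intro not_in_nil_if_overlapping_transpositions[OF y(1), of x "y x" "y (y x)"]) auto
    next
      case 2
      then have "y a \<noteq> c"
        using inj_eq[OF inj] by metis
      with 2 show ?thesis
        using in_range[of a] comp_transpose[OF inj, of a c]
        by (intro not_in_nil_if_overlapping_transpositions[OF y(1), of a c "y a"]) (auto simp: transpose_commute)
    next
      case 3
      \<comment> \<open>Degree five suffices to choose \<open>e\<close>; its image under \<open>y\<close> is then a sixth point.\<close>
      have outside: "\<exists>x\<in>{1..n}. x \<notin> A" if "card A < 5" "finite A" for A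
      proof (rule ccontr)
        assume "\<not> ?thesis"
        then have "card {1..n} \<le> card A"
          using that by (intro card_mono) auto
        then show False
          using that assms by simp
      qed
      obtain a where a: "a \<in> {1..n}"
        using outside[of "{}"] by auto
      obtain c where c: "c \<in> {1..n}" "c \<notin> {a, y a}"
        using outside[of "{a, y a}"] card_length[of "[a, y a]"] by auto
      obtain e where e: "e \<in> {1..n}" "e \<notin> {a, y a, c, y c}"
        using outside[of "{a, y a, c, y c}"] card_length[of "[a, y a, c, y c]"] by auto
      have "y u = v \<longleftrightarrow> u = y v" for u v
        using 3(1) by auto
      then have "distinct [a, c, e, y a, y c, y e]"
        using a c e 3(2) inj_eq[OF inj] by auto
      then show ?thesis
        using a c e 3(1) by (intro not_in_nil_if_involution_exchanges_three_pairs[OF y(1), of a c e]) auto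
    qed
  qed
  moreover have "id \<in> nil (sym_group n)"
    by (auto simp: nil_def sym_group_carrier sym_group_mult permutes_id intro!: nilpotent_if_commute)
  ultimately show ?thesis
    by (auto simp: nil_def sym_group_carrier)
qed

section \<open>Paths to transpositions\<close>

lemma (in group) prime_order_power:
  assumes "finite (carrier G)" "x \<in> carrier G" "x \<noteq> \<one>"
  obtains k :: nat where "prime (ord (x [^] k))"
proof -
  have "ord x \<noteq> 1" "ord x \<ge> 1"
    using assms ord_eq_1 ord_ge_1 by auto
  then obtain p where p: "prime p" "p dvd ord x"
    using prime_factor_nat by blast
  then have "ord x div p dvd ord x" "ord x div p \<noteq> 0"
    using \<open>ord x \<ge> 1\<close> by (auto simp: dvd_div_eq_0_iff div_dvd_iff_mult)
  then have "ord (x [^] (ord x div p)) = ord x div (ord x div p)"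
    using assms(2) by (intro ord_pow)
  also have "\<dots> = p"
    using p \<open>ord x \<ge> 1\<close> by (auto elim!: dvdE)
  finally show thesis
    using that p(1) by metis
qed

text \<open>All nontrivial orbits of \<open>y\<close> have size \<open>p\<close>. The permutation \<open>c\<close> is one of the \<open>p\<close>-cycles of \<open>y\<close>
  and \<open>A\<close> is its orbit.\<close>

lemma cycle_of_prime_order_permutation:
  assumes y: "y permutes S" "finite S" and p: "prime p" "y ^^ p = id" and a: "y a \<noteq> a"
  obtains c A where "c permutes A" "A \<subseteq> S" "card A = p" "c \<noteq> id" "y \<circ> c = c \<circ> y"
proof -
  let ?A = "set (support y a)" and ?c = "cycle_of_list (support y a)"
  have perm: "permutation y"
    using y permutation_permutes by blast
  have "least_power y a dvd p"
    using p(2) by (intro least_power_minimal) simp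
  then have "least_power y a = p"
    using p(1) least_power_gt_one[OF perm a] by (auto simp: prime_nat_iff)
  then have card: "card ?A = p"
    using distinct_card[OF cycle_of_permutation[OF perm, of a]] by simp
  have "a \<in> S"
    using y(1) a permutes_not_in by metis
  then have sub: "?A \<subseteq> S"
    using permutes_funpow[OF y(1)] by (auto simp: permutes_in_image)
  have a_in: "a \<in> ?A"
    unfolding support_set[OF perm] by (rule range_eqI[of _ _ 0]) simp
  have closed: "y x \<in> ?A" if "x \<in> ?A" for x
  proof -
    obtain i where "x = (y ^^ i) a"
      using \<open>x \<in> ?A\<close> unfolding support_set[OF perm] by auto
    then have "y x = (y ^^ Suc i) a"
      by simp
    then show ?thesis
      unfolding support_set[OF perm] by blast
  qed
  then have "y ` ?A = ?A"
    using permutes_inj[OF y(1)] by (intro endo_inj_surj) (auto intro: inj_on_subset)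
  then have closed_iff: "y x \<in> ?A \<longleftrightarrow> x \<in> ?A" for x
    using permutes_inj[OF y(1)] by (metis inj_image_mem_iff)
  have c: "?c x = (if x \<in> ?A then y x else x)" for x
    using cycle_restrict[OF perm, of x a] id_outside_supp[of x "support y a"] by auto
  have "y \<circ> ?c = ?c \<circ> y"
    using closed_iff by (simp only: fun_eq_iff comp_apply c if_distrib[of y]) simp
  moreover have "?c a \<noteq> id a"
    using a a_in c by simp
  then have "?c \<noteq> id"
    by metis
  ultimately show thesis
    using that[OF cycle_permutes sub card] by blast
qed

text \<open>Commuting elements generate an abelian group. The bound on the degree makes every element
  other than the identity a vertex.\<close>

lemma commuting_reachable:
  assumes "n \<ge> 5" "x permutes {1..n}" "z permutes {1..n}" "x \<noteq> id" "z \<noteq> id" "x \<circ> z = z \<circ> x"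
  shows "x \<rightarrow>\<^sup>*\<^bsub>with_proj (nilpotent_graph (sym_group n))\<^esub> z"
proof -
  let ?G = "sym_group n"
  interpret group ?G by (rule sym_group_is_group)
  interpret pair_graph "nilpotent_graph ?G"
    by (rule pair_graph_nilpotent_graph[OF finite_sym_group])
  have verts: "x \<in> pverts (nilpotent_graph ?G)" "z \<in> pverts (nilpotent_graph ?G)"
    using assms by (auto simp: nilpotent_graph_def nil_sym_group sym_group_carrier)
  show ?thesis
  proof (cases "x = z")
    case True
    then show ?thesis
      using verts by simp
  next
    case False
    have "nilpotent_group (subgroup_generated ?G {x, z})"
      using assms by (intro nilpotent_if_commute) (auto simp: sym_group_carrier sym_group_mult)
    then have "(x, z) \<in> parcs (nilpotent_graph ?G)"
      using False verts by (simp add: nilpotent_graph_def)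
    then show ?thesis
      by (intro reachable_adjI) simp
  qed
qed

lemma obtain_two_outside:
  fixes S A :: "'a set"
  assumes "finite S" "finite A" "card A + 2 \<le> card S"
  obtains u v where "u \<in> S" "v \<in> S" "u \<notin> A" "v \<notin> A" "u \<noteq> v"
proof -
  have "2 \<le> card (S - A)"
    using assms diff_card_le_card_Diff[of A S] by linarith
  then obtain T where "T \<subseteq> S - A" "card T = 2"
    by (meson obtain_subset_with_card_n)
  then show thesis
    using that by (auto simp: card_2_iff)
qed

text \<open>Disjoint transpositions commute. If two transpositions meet, they move at most three points
  together, and degree five leaves room for a transposition disjoint from both.\<close>

lemma transpositions_reachable:
  assumes "n \<ge> 5" "a \<noteq> b" "c \<noteq> d" "{a, b, c, d} \<subseteq> {1..n}"
  shows "transpose a b \<rightarrow>\<^sup>*\<^bsub>with_proj (nilpotent_graph (sym_group n))\<^esub> transpose c d"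
proof -
  interpret pair_graph "nilpotent_graph (sym_group n)"
    by (rule pair_graph_nilpotent_graph[OF finite_sym_group])
  have disjoint: "transpose i j \<rightarrow>\<^sup>*\<^bsub>with_proj (nilpotent_graph (sym_group n))\<^esub> transpose k l"
    if "i \<noteq> j" "k \<noteq> l" "{i, j} \<inter> {k, l} = {}" "{i, j, k, l} \<subseteq> {1..n}" for i j k l
  proof (rule commuting_reachable[OF assms(1)])
    show "transpose i j permutes {1..n}" "transpose k l permutes {1..n}"
      using that by (auto intro!: permutes_swap_id)
    show "transpose i j \<circ> transpose k l = transpose k l \<circ> transpose i j"
      using that comp_transpose[OF inj_transpose, of i j k l] by simp
  qed (use that in \<open>simp_all add: transpose_eq_id_iff\<close>)
  show ?thesis
  proof (cases "{a, b} \<inter> {c, d} = {}")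
    case False
    then have "{a, b, c, d} = {a, b, c} \<or> {a, b, c, d} = {a, b, d}"
      by auto
    moreover have "card {x, y, z} \<le> 3" for x y z :: nat
      using card_length[of "[x, y, z]"] by simp
    ultimately have "card {a, b, c, d} \<le> 3"
      by metis
    then have "card {a, b, c, d} + 2 \<le> card {1..n}"
      using assms(1) by simp
    then obtain e f where ef: "e \<in> {1..n}" "f \<in> {1..n}" "e \<notin> {a, b, c, d}" "f \<notin> {a, b, c, d}" "e \<noteq> f"
      using obtain_two_outside[of "{1..n}" "{a, b, c, d}"] by blast
    have "transpose a b \<rightarrow>\<^sup>*\<^bsub>with_proj (nilpotent_graph (sym_group n))\<^esub> transpose e f"
      using assms(2-4) ef by (intro disjoint) auto
    also have "transpose e f \<rightarrow>\<^sup>*\<^bsub>with_proj (nilpotent_graph (sym_group n))\<^esub> transpose c d"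
      using assms(2-4) ef by (intro disjoint) auto
    finally show ?thesis .
  qed (use assms disjoint in auto)
qed

text \<open>The path runs from \<open>x\<close> to a power \<open>y\<close> of prime order \<open>p\<close>, then to a single \<open>p\<close>-cycle \<open>c\<close> of \<open>y\<close>,
  and then to a transposition of two points outside the orbit of \<open>c\<close>. Such points exist since
  \<open>p\<close>, being prime, is neither \<open>n\<close> nor \<open>n - 1\<close>.\<close>

lemma transposition_reachable:
  assumes n: "n \<ge> 5" "\<not> prime n" "\<not> prime (n - 1)" and x: "x permutes {1..n}" "x \<noteq> id"
  obtains u v where "u \<noteq> v" "{u, v} \<subseteq> {1..n}"
    "x \<rightarrow>\<^sup>*\<^bsub>with_proj (nilpotent_graph (sym_group n))\<^esub> transpose u v"
proof -
  let ?G = "sym_group n"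
  interpret group ?G by (rule sym_group_is_group)
  interpret \<Gamma>: pair_graph "nilpotent_graph ?G"
    by (rule pair_graph_nilpotent_graph[OF finite_sym_group])
  obtain k :: nat where k: "prime (ord (x [^]\<^bsub>?G\<^esub> k))"
    using prime_order_power[OF finite_sym_group] x by (auto simp: sym_group_carrier sym_group_one)
  define y where "y = x ^^ k"
  define p where "p = ord y"
  have y: "y permutes {1..n}"
    unfolding y_def using x(1) by (rule permutes_funpow)
  have p: "prime p"
    using k by (simp add: p_def y_def pow_sym_group)
  have "y \<noteq> id"
    using p ord_eq_1[of y] y by (auto simp: p_def sym_group_carrier sym_group_one)
  then obtain a where a: "y a \<noteq> a"
    by (auto simp: fun_eq_iff)
  have "y ^^ p = id"
    using pow_ord_eq_1[of y] y by (simp add: p_def pow_sym_group sym_group_carrier sym_group_one)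
  then obtain c A where c: "c permutes A" "A \<subseteq> {1..n}" "card A = p" "c \<noteq> id" "y \<circ> c = c \<circ> y"
    using cycle_of_prime_order_permutation[OF y _ p _ a] by blast
  have "p \<noteq> n" "p \<noteq> n - 1" "p \<le> n"
    using n p c card_mono[of "{1..n}" A] by auto
  then have "card A + 2 \<le> card {1..n}"
    using c(3) by simp
  then obtain u v where uv: "u \<in> {1..n}" "v \<in> {1..n}" "u \<notin> A" "v \<notin> A" "u \<noteq> v"
    using obtain_two_outside[of "{1..n}" A] finite_subset[OF c(2)] by blast
  have "x \<circ> y = y \<circ> x"
    unfolding y_def by (metis funpow_Suc_right funpow.simps(2))
  moreover have "c \<circ> transpose u v = transpose u v \<circ> c"
    using comp_transpose[OF permutes_inj[OF c(1)]] uv c(1) by (simp add: permutes_not_in)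
  moreover have "c permutes {1..n}"
    using c(1,2) by (rule permutes_subset)
  moreover have "transpose u v permutes {1..n}"
    using uv by (intro permutes_swap_id) auto
  moreover have "transpose u v \<noteq> id"
    using uv by (simp add: transpose_eq_id_iff)
  ultimately have "x \<rightarrow>\<^sup>*\<^bsub>with_proj (nilpotent_graph ?G)\<^esub> y"
    "y \<rightarrow>\<^sup>*\<^bsub>with_proj (nilpotent_graph ?G)\<^esub> c"
    "c \<rightarrow>\<^sup>*\<^bsub>with_proj (nilpotent_graph ?G)\<^esub> transpose u v"
    using commuting_reachable[OF n(1)] x y \<open>y \<noteq> id\<close> c(4,5) by blast+
  then show thesis
    using that[of u v] uv \<Gamma>.reachable_trans by blast
qed

lemma connected_nilpotent_graph_sym_group:
  assumes "n \<ge> 5" "\<not> prime n" "\<not> prime (n - 1)"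
  shows "\<not> disconnected (nilpotent_graph (sym_group n))"
proof -
  let ?\<Gamma> = "nilpotent_graph (sym_group n)"
  interpret pair_graph ?\<Gamma>
    by (rule pair_graph_nilpotent_graph[OF finite_sym_group])
  have sym: "symmetric (with_proj ?\<Gamma>)"
    by (rule sym_arcs)
  have verts: "pverts ?\<Gamma> = {x. x permutes {1..n} \<and> x \<noteq> id}"
    using assms(1) by (auto simp: nilpotent_graph_def nil_sym_group sym_group_carrier)
  have "x \<rightarrow>\<^sup>*\<^bsub>with_proj ?\<Gamma>\<^esub> z" if "x \<in> pverts ?\<Gamma>" "z \<in> pverts ?\<Gamma>" for x z
  proof -
    have x: "x permutes {1..n}" "x \<noteq> id" and z: "z permutes {1..n}" "z \<noteq> id"
      using that verts by auto
    obtain a b where ab: "a \<noteq> b" "{a, b} \<subseteq> {1..n}" "x \<rightarrow>\<^sup>*\<^bsub>with_proj ?\<Gamma>\<^esub> transpose a b"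
      using transposition_reachable[OF assms x] .
    obtain c d where cd: "c \<noteq> d" "{c, d} \<subseteq> {1..n}" "z \<rightarrow>\<^sup>*\<^bsub>with_proj ?\<Gamma>\<^esub> transpose c d"
      using transposition_reachable[OF assms z] .
    have "transpose a b \<rightarrow>\<^sup>*\<^bsub>with_proj ?\<Gamma>\<^esub> transpose c d"
      using transpositions_reachable[OF assms(1)] ab cd by simp
    with ab(3) symmetric_reachable[OF sym cd(3)] show ?thesis
      using reachable_trans by blast
  qed
  then have "\<forall>x\<in>pverts ?\<Gamma>. \<forall>z\<in>pverts ?\<Gamma>. x \<rightarrow>\<^sup>*\<^bsub>with_proj (mk_symmetric (with_proj ?\<Gamma>))\<^esub> z"
    using reachable_mk_symmetric_eq[OF sym] by blast
  moreover have "transpose 1 2 \<in> pverts ?\<Gamma>"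
    using assms(1) by (auto simp: verts transpose_eq_id_iff intro: permutes_swap_id)
  ultimately show ?thesis
    unfolding disconnected_def Digraph_Component.connected_def strongly_connected_def by auto
qed

section \<open>The centralizer of a cycle of prime length\<close>

lemma cycle_upt_permutes: "cycle_of_list [1..<Suc p] permutes {1..p}"
  using cycle_permutes[of "[1..<Suc p]"] by (simp add: atLeastLessThanSuc_atLeastAtMost del: upt_Suc)

lemma cycle_upt_power:
  assumes "i < p"
  shows "(cycle_of_list [1..<Suc p] ^^ i) 1 = Suc i"
proof -
  have "map (cycle_of_list [1..<Suc p] ^^ i) [1..<Suc p] ! 0 = rotate i [1..<Suc p] ! 0"
    by (subst cyclic_rotation) simp_all
  then show ?thesis
    using assms by (simp add: nth_rotate del: upt_Suc)
qed

text \<open>A permutation \<open>g\<close> that commutes with \<open>c\<close> is determined on \<open>{1..p}\<close> by the value \<open>g 1\<close>. As \<open>c\<close>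
  has at most one fixed point, \<open>g\<close> fixes it, and \<open>g\<close> agrees everywhere with the power of \<open>c\<close> that takes
  \<open>1\<close> to \<open>g 1\<close>.\<close>

lemma commutes_with_cycle_imp_power:
  assumes p: "2 \<le> p" "n = p \<or> n = Suc p" and c: "c = cycle_of_list [1..<Suc p]"
    and g: "g permutes {1..n}" "g \<circ> c = c \<circ> g"
  obtains i where "g = c ^^ i"
proof -
  have power: "(c ^^ i) 1 = Suc i" if "i < p" for i
    unfolding c using that by (rule cycle_upt_power)
  have c_perm: "c permutes {1..p}"
    unfolding c by (rule cycle_upt_permutes)
  have comm: "g ((c ^^ j) x) = (c ^^ j) (g x)" for j x
    using g(2) by (induction j) (simp_all add: fun_eq_iff)
  \<comment> \<open>Otherwise \<open>g 1\<close> would be fixed by \<open>c\<close>, and with it \<open>1\<close>.\<close>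
  have "g 1 \<in> {1..p}"
  proof (rule ccontr)
    assume "g 1 \<notin> {1..p}"
    then have "g (c 1) = g 1"
      using comm[of 1 1] c_perm by (simp add: permutes_not_in)
    then have "c 1 = 1"
      using permutes_inj[OF g(1)] by (simp add: inj_eq)
    then show False
      using power[of 1] p(1) by simp
  qed
  then obtain i where i: "i < p" "g 1 = (c ^^ i) 1"
    using power[of "g 1 - 1"] by (metis Suc_pred' atLeastAtMost_iff less_eq_Suc_le One_nat_def)
  have eq: "g x = (c ^^ i) x" if "x \<in> {1..p}" for x
  proof -
    have "x = (c ^^ (x - 1)) 1"
      using power[of "x - 1"] that by (cases x) auto
    then have "g x = (c ^^ (x - 1)) ((c ^^ i) 1)"
      using comm i(2) by metis
    also have "\<dots> = (c ^^ i) x"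
      using \<open>x = _\<close> by (metis add.commute comp_apply funpow_add)
    finally show ?thesis .
  qed
  have ci: "(c ^^ i) permutes {1..p}"
    using c_perm by (rule permutes_funpow)
  have "g permutes {1..p}"
  proof (rule permutes_superset[OF g(1)])
    fix x assume "x \<in> {1..n} - {1..p}"
    then have x: "x = Suc p" "n = Suc p"
      using p by auto
    show "g x = x"
    proof (rule ccontr)
      assume "g x \<noteq> x"
      then have "g x \<in> {1..p}"
        using permutes_in_image[OF g(1), of x] x by auto
      then obtain z where "z \<in> {1..p}" "g x = (c ^^ i) z"
        using permutes_image[OF ci] by (metis imageE)
      then have "g x = g z"
        using eq by simp
      then have "x = z"
        using permutes_inj[OF g(1)] by (simp add: inj_eq)
      then show False
        using x(1) \<open>z \<in> {1..p}\<close> by simp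
    qed
  qed
  then have "g x = (c ^^ i) x" for x
    using eq[of x] permutes_not_in[OF ci, of x] permutes_not_in[of g "{1..p}" x] by metis
  then have "g = c ^^ i"
    by blast
  then show thesis
    by (rule that)
qed

lemma cycle_self_centralizing:
  assumes p: "prime p" "n = p \<or> n = Suc p" and c: "c = cycle_of_list [1..<Suc p]"
  defines "U \<equiv> generate (sym_group n) {c}"
  shows "cyclic_subgroup U (sym_group n)" "self_centralizing U (sym_group n)" "card U = p"
proof -
  let ?G = "sym_group n"
  interpret group ?G by (rule sym_group_is_group)
  have p2: "2 \<le> p"
    using p(1) by (rule prime_ge_2_nat)
  have "c permutes {1..p}"
    unfolding c by (rule cycle_upt_permutes)
  then have cG: "c \<in> carrier ?G"
    using p(2) by (auto simp: sym_group_carrier intro: permutes_subset)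
  then have sub: "subgroup U ?G"
    unfolding U_def by (intro generate_is_subgroup) simp
  have "subgroup_generated ?G {c} = ?G\<lparr>carrier := U\<rparr>"
    using cG by (simp add: subgroup_generated_def U_def)
  then show "cyclic_subgroup U ?G"
    unfolding cyclic_subgroup_def using sub cyclic_group_generated[of c] by simp
  have "c 1 \<noteq> 1"
    using cycle_upt_power[of 1 p] p2 by (simp add: c del: upt_Suc)
  then have "c \<noteq> id"
    by auto
  have "c ^^ p = id"
    unfolding c using cycle_is_id_root[of "[1..<Suc p]"] by (simp del: upt_Suc)
  then have "ord c dvd p"
    using cG by (simp add: pow_sym_group sym_group_one flip: pow_eq_id)
  then have "ord c = p"
    using p(1) ord_eq_1[OF cG] \<open>c \<noteq> id\<close> by (auto simp: prime_nat_iff sym_group_one)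
  then show "card U = p"
    unfolding U_def using generate_pow_card[OF cG] by simp
  have "U \<subseteq> centralizer ?G {c}"
    unfolding U_def using cG by (intro generate_in_centralizer) auto
  then have "U \<subseteq> centralizer ?G U"
    unfolding U_def using cG subgroup.subset[OF sub, unfolded U_def]
    by (intro generate_in_centralizer) (auto simp: centralizer_def)
  moreover have "centralizer ?G U \<subseteq> U"
  proof
    fix g assume g: "g \<in> centralizer ?G U"
    moreover have "c \<in> U"
      unfolding U_def by (simp add: generate.incl)
    ultimately have "g permutes {1..n}" "g \<circ> c = c \<circ> g"
      by (auto simp: centralizer_def sym_group_carrier sym_group_mult)
    then obtain i where "g = c ^^ i"
      using commutes_with_cycle_imp_power[OF p2 p(2) c] by blast
    then show "g \<in> U"
      unfolding U_def generate_pow_on_finite_carrier[OF finite_sym_group cG]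
      by (auto simp: pow_sym_group)
  qed
  ultimately show "self_centralizing U ?G"
    using sub by (auto simp: self_centralizing_def)
qed

section \<open>Connectedness of the nilpotent graph of the symmetric group\<close>

theorem theorem3p6:
  fixes n :: nat
  assumes "n \<ge> 3"
  shows "(prime n \<or> prime (n - 1) \<longrightarrow>
            (\<exists>U. cyclic_subgroup U (sym_group n) \<and> self_centralizing U (sym_group n)) \<and>
            disconnected (nilpotent_graph (sym_group n)))
       \<and> (n \<ge> 5 \<and> disconnected (nilpotent_graph (sym_group n)) \<longrightarrow>
            prime n \<or> prime (n - 1))"
proof (intro conjI impI)
  assume "prime n \<or> prime (n - 1)"
  then obtain p where p: "prime p" "n = p \<or> n = Suc p"
    using assms by (metis Suc_pred' gr0I not_numeral_le_zero)
  obtain U where U: "cyclic_subgroup U (sym_group n)" "self_centralizing U (sym_group n)" "card U = p"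
    using cycle_self_centralizing[OF p refl] by blast
  have "card (carrier (sym_group n)) = fact n"
    by (simp add: sym_group_def card_permutations)
  moreover have "n < fact n"
  proof (cases n)
    case (Suc m)
    then have "n < Suc m * 2"
      by simp
    also have "\<dots> \<le> Suc m * fact m"
      using Suc assms fact_ge_self[of m] by (intro mult_le_mono2) linarith
    also have "\<dots> = fact n"
      using Suc by (simp only: fact_Suc of_nat_id)
    finally show ?thesis .
  qed (use assms in simp)
  ultimately have "U \<noteq> carrier (sym_group n)"
    using U(3) p(2) by auto
  then show "disconnected (nilpotent_graph (sym_group n))"
    using group.disconnected_if_self_centralizing_prime[OF sym_group_is_group U(2)] U(3) p(1) by simp
  show "\<exists>U. cyclic_subgroup U (sym_group n) \<and> self_centralizing U (sym_group n)"
    using U by blast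
next
  assume "n \<ge> 5 \<and> disconnected (nilpotent_graph (sym_group n))"
  then show "prime n \<or> prime (n - 1)"
    using connected_nilpotent_graph_sym_group by blast
qed

end
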